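(* For $n\ge 1$ let $$A_n(s,t)=\sum_{\pi\in\mathfrak{S}_n}s^{\mathrm{des}(\pi)}t^{\mathrm{exc}(\pi)},\qquad a_n(s,t)=\frac{A_n(s,t)-t^nA_n(s,1/t)}{1-t},$$ and set $a_0(s,t)=0$. Then for every $n\ge 1$, $a_n(s,t)$ is a $t$-symmetric polynomial, i.e. $a_n(s,t)\in\mathbb{Z}[s,t]$ and $t^{n-1}a_n(s,1/t)=a_n(s,t)$, and $A_n(s,t)$ has the $t$-symmetric decomposition $$A_n(s,t)=a_n(s,t)+(s-1)\,t\,a_{n-1}(s,t).$$
   Context: $\mathfrak{S}_n$ is the set of permutations $\pi=\pi(1)\cdots\pi(n)$ of $[n]=\{1,\dots,n\}$. $\mathrm{des}(\pi)$ is the number of descents of $\pi$, i.e. of indices $i\in\{1,\dots,n-1\}$ with $\pi(i)>\pi(i+1)$. $\mathrm{exc}(\pi)$ is the number of excedances of $\pi$, i.e. of indices $i\in\{1,\dots,n\}$ with $\pi(i)>i$. As a polynomial in $t$, $A_n(s,t)$ has degree $n-1$. A $t$-symmetric decomposition of $A_n(s,t)$ is an expression $A_n(s,t)=a(s,t)+t\,b(s,t)$ with polynomials $a,b$ satisfying $t^{n-1}a(s,1/t)=a(s,t)$ and $t^{n-2}b(s,1/t)=b(s,t)$. Here $a=a_n$ and $b=(s-1)a_{n-1}$. *)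

theory Defs
  imports
    "HOL-Computational_Algebra.Computational_Algebra"
    "HOL-Combinatorics.Permutations"
begin

definition des :: "nat \<Rightarrow> (nat \<Rightarrow> nat) \<Rightarrow> nat" where
  "des n \<pi> = card {i \<in> {1..<n}. \<pi> i > \<pi> (i + 1)}"

definition exc :: "nat \<Rightarrow> (nat \<Rightarrow> nat) \<Rightarrow> nat" where
  "exc n \<pi> = card {i \<in> {1..n}. \<pi> i > i}"

text \<open>
  The ring of polynomials in \<open>s\<close> and \<open>t\<close> with integer coefficients is represented by
  \<^typ>\<open>int poly poly\<close>: the outer variable is \<open>t\<close>, the variable of the coefficients is \<open>s\<close>.
  Its fraction field \<^typ>\<open>int poly poly fract\<close> is the field of rational functions in \<open>s, t\<close>.
\<close>

definition var_s :: "int poly poly" where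
  "var_s = [:[:0, 1:]:]"

definition var_t :: "int poly poly" where
  "var_t = [:0, 1:]"

definition A_poly :: "nat \<Rightarrow> int poly poly" where
  "A_poly n = (\<Sum>\<pi> | \<pi> permutes {1..n}. var_s ^ des n \<pi> * var_t ^ exc n \<pi>)"

text \<open>The rational function \<open>p(s, 1/t)\<close>, obtained by evaluating \<open>p\<close> at \<open>1/t\<close>.\<close>

definition subst_inv_t :: "int poly poly \<Rightarrow> int poly poly fract" where
  "subst_inv_t p = poly (map_poly (\<lambda>c. to_fract [:c:]) p) (1 / to_fract var_t)"

definition a_rat :: "nat \<Rightarrow> int poly poly fract" where
  "a_rat n =
     (if n = 0 then 0
      else (to_fract (A_poly n) - to_fract var_t ^ n * subst_inv_t (A_poly n)) / (1 - to_fract var_t))"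

text \<open>
  The symmetry \<open>t\<^sup>d p(s, 1/t) = p(s, t)\<close>. The exponent is an integer because \<open>d = -1\<close> occurs
  for the second component of a decomposition when \<open>n = 1\<close>; then only \<open>p = 0\<close> is symmetric.
\<close>

definition t_symmetric :: "int \<Rightarrow> int poly poly \<Rightarrow> bool" where
  "t_symmetric d p \<longleftrightarrow> to_fract var_t powi d * subst_inv_t p = to_fract p"

definition t_symmetric_decomposition ::
    "nat \<Rightarrow> int poly poly \<Rightarrow> int poly poly \<Rightarrow> int poly poly \<Rightarrow> bool" where
  "t_symmetric_decomposition n f a b \<longleftrightarrow>
     f = a + var_t * b \<and> t_symmetric (int n - 1) a \<and> t_symmetric (int n - 2) b"

end

theory Submission
  imports Defs
begin

text \<open>
  Reversing and complementing a permutation preserves descents and exchanges excedances with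
  anti-excedances, so \<open>t\<^sup>n A\<^sub>n(s, 1/t)\<close> is the generating function of descents and weak excedances.
  Increasing all values of \<open>\<pi>\<close> cyclically by one lowers the number of weak excedances by one to
  the number of excedances, and it changes the number of descents only if the value \<open>n\<close> stands in
  the first or in the last place. Deleting that value in these two cases gives
  \<open>t\<^sup>n A\<^sub>n(s, 1/t) - t A\<^sub>n(s, t) = (s - 1) t (A\<^sub>n\<^sub>-\<^sub>1(s, t) - t\<^sup>n\<^sup>-\<^sup>1 A\<^sub>n\<^sub>-\<^sub>1(s, 1/t))\<close>,
  which is the claimed decomposition multiplied by \<open>1 - t\<close>.
\<close>

section \<open>Weak excedances\<close>

definition wexc :: "nat \<Rightarrow> (nat \<Rightarrow> nat) \<Rightarrow> nat" where
  "wexc n \<pi> = card {i \<in> {1..n}. \<pi> i \<ge> i}"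

section \<open>Reversal of places and complementation of values\<close>

definition complement :: "nat \<Rightarrow> nat \<Rightarrow> nat" where
  "complement n i = (if i \<in> {1..n} then n + 1 - i else i)"

lemma complement_complement [simp]: "complement n (complement n i) = i"
  by (auto simp: complement_def)

lemma complement_in_iff [simp]: "complement n i \<in> {1..n} \<longleftrightarrow> i \<in> {1..n}"
  by (auto simp: complement_def)

lemma complement_permutes: "complement n permutes {1..n}"
proof (rule bij_imp_permutes)
  show "bij_betw (complement n) {1..n} {1..n}"
    by (rule bij_betw_byWitness[where f' = "complement n"]) (auto simp: complement_def)
qed (auto simp: complement_def)

lemma exc_le: "exc n \<pi> \<le> n"
proof -
  have "card {i \<in> {1..n}. \<pi> i > i} \<le> card {1..n}"
    by (rule card_mono) auto
  then show ?thesis by (simp add: exc_def)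
qed

text \<open>Conjugation moves the pair \<open>(i, \<pi> i)\<close> to
  \<open>(n + 1 - i, n + 1 - \<pi> i)\<close> and so reverses the comparison of place and value. The
  weak excedances obtained come from the places with \<open>\<pi> i \<le> i\<close>, which are the
  non-excedances of \<open>\<pi>\<close>.\<close>

lemma wexc_reverse_complement:
  assumes "\<pi> permutes {1..n}"
  shows "wexc n (complement n \<circ> \<pi> \<circ> complement n) = n - exc n \<pi>"
proof -
  have "bij_betw (complement n) {i \<in> {1..n}. \<pi> i \<le> i}
          {i \<in> {1..n}. (complement n \<circ> \<pi> \<circ> complement n) i \<ge> i}"
  proof (rule bij_betw_byWitness[where f' = "complement n"])
    show "complement n ` {i \<in> {1..n}. \<pi> i \<le> i}
        \<subseteq> {i \<in> {1..n}. (complement n \<circ> \<pi> \<circ> complement n) i \<ge> i}"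
    proof clarify
      fix i assume i: "i \<in> {1..n}" "\<pi> i \<le> i"
      moreover have "\<pi> i \<in> {1..n}"
        using permutes_in_image[OF assms] i by blast
      ultimately have "complement n i \<le> complement n (\<pi> i)"
        by (simp add: complement_def)
      with i show "complement n i \<in> {1..n}
          \<and> complement n i \<le> (complement n \<circ> \<pi> \<circ> complement n) (complement n i)"
        by (simp del: atLeastAtMost_iff One_nat_def)
    qed
    show "complement n ` {i \<in> {1..n}. (complement n \<circ> \<pi> \<circ> complement n) i \<ge> i}
        \<subseteq> {i \<in> {1..n}. \<pi> i \<le> i}"
    proof clarify
      fix i assume i: "i \<in> {1..n}" "i \<le> (complement n \<circ> \<pi> \<circ> complement n) i"
      moreover have "complement n i \<in> {1..n}" "\<pi> (complement n i) \<in> {1..n}"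
        using permutes_in_image[OF assms] complement_in_iff i by blast+
      moreover have "complement n i = n + 1 - i"
        using i by (simp add: complement_def)
      moreover have "complement n (\<pi> (complement n i)) = n + 1 - \<pi> (complement n i)"
        using calculation by (simp add: complement_def del: One_nat_def)
      ultimately show "complement n i \<in> {1..n} \<and> \<pi> (complement n i) \<le> complement n i"
        by (simp only: o_apply atLeastAtMost_iff simp_thms) linarith
    qed
  qed auto
  from bij_betw_same_card[OF this]
  have "wexc n (complement n \<circ> \<pi> \<circ> complement n) = card {i \<in> {1..n}. \<pi> i \<le> i}"
    unfolding wexc_def by (rule sym)
  also have "{i \<in> {1..n}. \<pi> i \<le> i} = {1..n} - {i \<in> {1..n}. \<pi> i > i}"
    by auto
  also have "card \<dots> = n - exc n \<pi>"
    unfolding exc_def by (subst card_Diff_subset) auto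
  finally show ?thesis .
qed

text \<open>Reversing the places turns descents into ascents and complementing the values turns them
  back. The places \<open>i\<close>, \<open>i + 1\<close> are read at \<open>n - i + 1\<close>,
  \<open>n - i\<close>, so descent \<open>i\<close> matches descent \<open>n - i\<close>.\<close>

lemma des_reverse_complement:
  assumes "\<pi> permutes {1..n}"
  shows "des n (complement n \<circ> \<pi> \<circ> complement n) = des n \<pi>"
proof -
  let ?\<rho> = "complement n \<circ> \<pi> \<circ> complement n"
  have descent: "?\<rho> i > ?\<rho> (i + 1) \<longleftrightarrow> \<pi> (n - i) > \<pi> (n - i + 1)" if i: "i \<in> {1..<n}" for i
  proof -
    have "complement n i = n - i + 1" "complement n (i + 1) = n - i"
      using i by (auto simp: complement_def)
    moreover have "n - i \<in> {1..n}" "n - i + 1 \<in> {1..n}"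
      using i by auto
    then have "\<pi> (n - i) \<in> {1..n}" "\<pi> (n - i + 1) \<in> {1..n}"
      using permutes_in_image[OF assms] by blast+
    then have "complement n (\<pi> (n - i + 1)) > complement n (\<pi> (n - i)) \<longleftrightarrow> \<pi> (n - i) > \<pi> (n - i + 1)"
      unfolding complement_def by (simp, linarith)
    ultimately show ?thesis
      by simp
  qed
  have "bij_betw (\<lambda>i. n - i) {i \<in> {1..<n}. \<pi> i > \<pi> (i + 1)} {i \<in> {1..<n}. ?\<rho> i > ?\<rho> (i + 1)}"
  proof (rule bij_betw_byWitness[where f' = "\<lambda>i. n - i"])
    show "(\<lambda>i. n - i) ` {i \<in> {1..<n}. \<pi> i > \<pi> (i + 1)} \<subseteq> {i \<in> {1..<n}. ?\<rho> i > ?\<rho> (i + 1)}"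
    proof clarify
      fix i assume i: "i \<in> {1..<n}" "\<pi> i > \<pi> (i + 1)"
      then have "n - i \<in> {1..<n}" "n - (n - i) = i" by auto
      then show "n - i \<in> {1..<n} \<and> ?\<rho> (n - i) > ?\<rho> (n - i + 1)"
        using descent[of "n - i"] i by simp
    qed
    show "(\<lambda>i. n - i) ` {i \<in> {1..<n}. ?\<rho> i > ?\<rho> (i + 1)} \<subseteq> {i \<in> {1..<n}. \<pi> i > \<pi> (i + 1)}"
    proof clarify
      fix i assume i: "i \<in> {1..<n}" "?\<rho> i > ?\<rho> (i + 1)"
      then have "n - i \<in> {1..<n}" by auto
      then show "n - i \<in> {1..<n} \<and> \<pi> (n - i) > \<pi> (n - i + 1)"
        using descent[OF i(1)] i(2) by blast
    qed
  qed auto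
  from bij_betw_same_card[OF this] show ?thesis
    unfolding des_def by (rule sym)
qed

section \<open>The generating function of descents and weak excedances\<close>

definition W_poly :: "nat \<Rightarrow> int poly poly" where
  "W_poly n = (\<Sum>\<pi> | \<pi> permutes {1..n}. var_s ^ des n \<pi> * var_t ^ wexc n \<pi>)"

text \<open>Reindexing by the involution that conjugates with \<open>complement n\<close>. In this
  form the exponents of t are those of \<open>A_poly n\<close> subtracted from n, ready for the
  substitution of 1/t.\<close>

lemma W_poly_eq_reversed:
  "W_poly n = (\<Sum>\<pi> | \<pi> permutes {1..n}. var_s ^ des n \<pi> * var_t ^ (n - exc n \<pi>))"
proof -
  let ?r = "\<lambda>\<pi>. complement n \<circ> \<pi> \<circ> complement n"
  have "bij_betw ?r {\<pi>. \<pi> permutes {1..n}} {\<pi>. \<pi> permutes {1..n}}"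
    by (rule bij_betw_byWitness[where f' = ?r])
      (auto simp: fun_eq_iff simp del: One_nat_def intro!: permutes_compose complement_permutes)
  from sum.reindex_bij_betw[OF this, of "\<lambda>\<pi>. var_s ^ des n \<pi> * var_t ^ wexc n \<pi>"]
  show ?thesis
    unfolding W_poly_def by (auto simp: des_reverse_complement wexc_reverse_complement)
qed

section \<open>Cyclic shift of the values\<close>

text \<open>It serves twice: \<open>cyc n \<circ> \<pi>\<close> rotates the values of a word, while
  \<open>\<tau> \<circ> inv (cyc n)\<close> rotates its places and brings the last entry to the
  front.\<close>

definition cyc :: "nat \<Rightarrow> nat \<Rightarrow> nat" where
  "cyc n i = (if i = n then 1 else if i \<in> {1..<n} then i + 1 else i)"

lemma cyc_permutes: "n \<ge> 1 \<Longrightarrow> cyc n permutes {1..n}"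
proof (rule bij_imp_permutes)
  assume "n \<ge> 1"
  then show "bij_betw (cyc n) {1..n} {1..n}"
    by (intro bij_betw_byWitness[where f' = "\<lambda>i. if i = 1 then n else i - 1"])
      (auto simp: cyc_def)
qed (auto simp: cyc_def)

lemma inv_cyc:
  assumes "i \<in> {1..n}"
  shows "inv (cyc n) i = (if i = 1 then n else i - 1)"
  using assms permutes_inj[OF cyc_permutes, of n]
  by (intro inv_f_eq) (auto simp: cyc_def)

text \<open>Away from the place of n every value grows by one, so \<open>\<pi> i \<ge> i\<close>
  becomes a strict inequality. At the place of n the value drops to 1, and exactly this weak
  excedance is lost.\<close>

lemma Suc_exc_cyc:
  assumes "\<pi> permutes {1..n}" "n \<ge> 1"
  shows "Suc (exc n (cyc n \<circ> \<pi>)) = wexc n \<pi>"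
proof -
  define k where "k = inv \<pi> n"
  have k: "k \<in> {1..n}" "\<pi> k = n"
    using assms permutes_in_image[OF permutes_inv[OF assms(1)], of n] by (simp_all add: k_def permutes_inverses)
  have "{i \<in> {1..n}. \<pi> i \<ge> i} = insert k {i \<in> {1..n}. (cyc n \<circ> \<pi>) i > i}" (is "_ = insert k ?E")
  proof (intro set_eqI)
    fix i
    show "i \<in> {i \<in> {1..n}. \<pi> i \<ge> i} \<longleftrightarrow> i \<in> insert k ?E"
    proof (cases "i \<in> {1..n} \<and> i \<noteq> k")
      case True
      then have "\<pi> i \<noteq> n"
        using k permutes_inj[OF assms(1)] by (metis injD)
      moreover have "\<pi> i \<in> {1..n}"
        using permutes_in_image[OF assms(1)] True by simp
      ultimately show ?thesis
        using True by (auto simp: cyc_def)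
    qed (use k in auto)
  qed
  moreover have "k \<notin> ?E"
    using k by (simp add: cyc_def)
  ultimately show ?thesis
    unfolding exc_def wexc_def by simp
qed

text \<open>An interior value \<open>n\<close> is the top of one descent, and its replacement \<open>1\<close> the bottom of one.\<close>

lemma des_cyc:
  assumes "\<pi> permutes {1..n}" "n \<ge> 1"
  shows "des n (cyc n \<circ> \<pi>) + of_bool (\<pi> 1 = n) = des n \<pi> + of_bool (\<pi> n = n)"
proof -
  define k where "k = inv \<pi> n"
  \<comment> \<open>The descents that do not involve the entry n; both compared values grow by one,
    so the shift keeps them.\<close>
  define X where "X = {i \<in> {1..<n}. i \<noteq> k \<and> i + 1 \<noteq> k \<and> \<pi> i > \<pi> (i + 1)}"
  have k: "k \<in> {1..n}" "\<pi> k = n"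
    using assms permutes_in_image[OF permutes_inv[OF assms(1)], of n] by (simp_all add: k_def permutes_inverses)
  have eq_k: "\<pi> i = n \<longleftrightarrow> i = k" for i
    using k permutes_inj[OF assms(1)] by (metis injD)
  have range: "1 \<le> \<pi> i" "\<pi> i \<le> n" if "i \<in> {1..n}" for i
    using permutes_in_image[OF assms(1)] that by auto
  have less: "\<pi> i < n" if "i \<in> {1..n}" "i \<noteq> k" for i
    using range[of i] eq_k[of i] that by linarith
  have val: "(cyc n \<circ> \<pi>) i = (if i = k then 1 else \<pi> i + 1)" if "i \<in> {1..n}" for i
  proof (cases "i = k")
    case False
    then show ?thesis
      using range[OF that] less[OF that] by (simp add: cyc_def)
  qed (simp add: k cyc_def)
  have des_iff: "\<pi> i > \<pi> (i + 1) \<longleftrightarrow> i \<in> X \<or> i = k"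
    and des_cyc_iff: "(cyc n \<circ> \<pi>) i > (cyc n \<circ> \<pi>) (i + 1) \<longleftrightarrow> i \<in> X \<or> i + 1 = k"
    if i: "i \<in> {1..<n}" for i
  proof -
    have in_range: "i \<in> {1..n}" "i + 1 \<in> {1..n}"
      using i by auto
    consider "i = k" | "i + 1 = k" | "i \<noteq> k" "i + 1 \<noteq> k" by blast
    then have "(\<pi> i > \<pi> (i + 1) \<longleftrightarrow> i \<in> X \<or> i = k)
      \<and> ((cyc n \<circ> \<pi>) i > (cyc n \<circ> \<pi>) (i + 1) \<longleftrightarrow> i \<in> X \<or> i + 1 = k)"
    proof cases
      case 1
      have "\<pi> (i + 1) < \<pi> i"
        using less[OF in_range(2)] 1 k by simp
      then show ?thesis
        unfolding val[OF in_range(1)] val[OF in_range(2)] using 1 by (simp add: X_def)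
    next
      case 2
      have "\<pi> i < \<pi> (i + 1)" "1 \<le> \<pi> i"
        using less[OF in_range(1)] range[OF in_range(1)] 2 k by simp_all
      then show ?thesis
        unfolding val[OF in_range(1)] val[OF in_range(2)] using 2 by (simp add: X_def)
    next
      case 3
      then show ?thesis
        unfolding val[OF in_range(1)] val[OF in_range(2)] using i by (simp add: X_def)
    qed
    then show "\<pi> i > \<pi> (i + 1) \<longleftrightarrow> i \<in> X \<or> i = k"
      and "(cyc n \<circ> \<pi>) i > (cyc n \<circ> \<pi>) (i + 1) \<longleftrightarrow> i \<in> X \<or> i + 1 = k"
      by blast+
  qed
  have "i \<in> {1..<n}" if "i \<in> X" for i
    using that by (simp add: X_def)
  \<comment> \<open>The extra descent of \<open>\<pi>\<close> at \<open>k\<close> needs a right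
    neighbour, that of the shifted word at \<open>k - 1\<close> a left one. The indicator terms fill
    in the missing cases, and both sides become \<open>card X + 1\<close>.\<close>
  then have D: "{i \<in> {1..<n}. \<pi> i > \<pi> (i + 1)} = X \<union> {i. i = k \<and> k < n}"
    and D': "{i \<in> {1..<n}. (cyc n \<circ> \<pi>) i > (cyc n \<circ> \<pi>) (i + 1)} = X \<union> {i. i + 1 = k \<and> 1 < k}"
    using des_iff des_cyc_iff k(1) by auto
  have fin: "finite X" unfolding X_def by simp
  have "card (X \<union> {i. i = k \<and> k < n}) = card X + of_bool (k < n)"
    using fin by (subst card_Un_disjoint) (auto simp: X_def)
  moreover have "card (X \<union> {i. i + 1 = k \<and> 1 < k}) = card X + of_bool (1 < k)"
  proof -
    have "{i. i + 1 = k \<and> 1 < k} = (if 1 < k then {k - 1} else {})" by auto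
    then show ?thesis
      using fin by (subst card_Un_disjoint) (auto simp: X_def)
  qed
  ultimately show ?thesis
    unfolding des_def D D' using eq_k[of 1] eq_k[of n] k by auto
qed

section \<open>Permutations with the maximum in the first or last place\<close>

text \<open>A permutation of a set is the identity outside it, so deleting a final maximum leaves
  the function itself unchanged.\<close>

lemma permutes_max_last_iff:
  "(\<pi> permutes {1..Suc m} \<and> \<pi> (Suc m) = Suc m) \<longleftrightarrow> \<pi> permutes {1..m}"
proof
  assume "\<pi> permutes {1..Suc m} \<and> \<pi> (Suc m) = Suc m"
  then show "\<pi> permutes {1..m}"
    using permutes_superset[of \<pi> "{1..Suc m}" "{1..m}"] by (auto simp: atLeastAtMostSuc_conv)
next
  assume *: "\<pi> permutes {1..m}"
  then show "\<pi> permutes {1..Suc m} \<and> \<pi> (Suc m) = Suc m"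
    using permutes_subset[OF *, of "{1..Suc m}"] permutes_not_in[OF *, of "Suc m"] by auto
qed

text \<open>Viewed on \<open>{1..Suc m}\<close>, \<open>\<tau>\<close> ends with its maximum;
  rotating the places brings this entry to the front.\<close>

lemma bij_betw_max_first:
  "bij_betw (\<lambda>\<tau>. \<tau> \<circ> inv (cyc (Suc m))) {\<tau>. \<tau> permutes {1..m}}
     {\<pi>. \<pi> permutes {1..Suc m} \<and> \<pi> 1 = Suc m}"
proof -
  have c: "cyc (Suc m) permutes {1..Suc m}"
    by (rule cyc_permutes) simp
  show ?thesis
  proof (rule bij_betw_byWitness[where f' = "\<lambda>\<pi>. \<pi> \<circ> cyc (Suc m)"])
    show "(\<lambda>\<tau>. \<tau> \<circ> inv (cyc (Suc m))) ` {\<tau>. \<tau> permutes {1..m}}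
        \<subseteq> {\<pi>. \<pi> permutes {1..Suc m} \<and> \<pi> 1 = Suc m}"
    proof clarify
      fix \<tau> assume "\<tau> permutes {1..m}"
      then have "\<tau> permutes {1..Suc m}" "\<tau> (Suc m) = Suc m"
        using permutes_max_last_iff[of \<tau> m] by blast+
      then show "\<tau> \<circ> inv (cyc (Suc m)) permutes {1..Suc m} \<and> (\<tau> \<circ> inv (cyc (Suc m))) 1 = Suc m"
        using permutes_compose[OF permutes_inv[OF c]] by (simp add: inv_cyc)
    qed
    show "(\<lambda>\<pi>. \<pi> \<circ> cyc (Suc m)) ` {\<pi>. \<pi> permutes {1..Suc m} \<and> \<pi> 1 = Suc m} \<subseteq> {\<tau>. \<tau> permutes {1..m}}"
    proof clarify
      fix \<pi> assume "\<pi> permutes {1..Suc m}" "\<pi> 1 = Suc m"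
      then have "\<pi> \<circ> cyc (Suc m) permutes {1..Suc m}" "(\<pi> \<circ> cyc (Suc m)) (Suc m) = Suc m"
        using permutes_compose[OF c] by (simp_all add: cyc_def)
      then show "\<pi> \<circ> cyc (Suc m) permutes {1..m}"
        using permutes_max_last_iff by blast
    qed
  qed (auto simp: comp_assoc permutes_inv_o[OF c])
qed

text \<open>The leading maximum makes a descent with the entry after it, which exists because
  \<open>m \<ge> 1\<close>; the descents of \<open>\<tau>\<close> move one place to the
  right.\<close>

lemma des_max_first:
  assumes "\<tau> permutes {1..m}" "m \<ge> 1"
  shows "des (Suc m) (\<tau> \<circ> inv (cyc (Suc m))) = Suc (des m \<tau>)"
proof -
  have top: "\<tau> (Suc m) = Suc m" and one: "\<tau> 1 \<le> m"
    using permutes_not_in[OF assms(1), of "Suc m"] permutes_in_image[OF assms(1), of 1] assms(2) by auto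
  have "{i \<in> {1..<Suc m}. (\<tau> \<circ> inv (cyc (Suc m))) i > (\<tau> \<circ> inv (cyc (Suc m))) (i + 1)}
      = insert 1 (Suc ` {i \<in> {1..<m}. \<tau> i > \<tau> (i + 1)})" (is "?L = ?R")
  proof (intro set_eqI)
    fix i show "i \<in> ?L \<longleftrightarrow> i \<in> ?R"
      using assms(2) top one
      by (cases i; cases "i = 1") (auto simp: inv_cyc image_iff)
  qed
  then show ?thesis
    unfolding des_def by (subst \<open>?L = ?R\<close>) (auto simp: card_insert_if card_image)
qed

text \<open>The entry \<open>\<tau> i\<close> moves to place \<open>i + 1\<close>, where being a
  weak excedance means \<open>\<tau> i > i\<close>. Hence weak excedances turn into excedances here;
  the additional one is place 1.\<close>

lemma wexc_max_first:
  assumes "\<tau> permutes {1..m}"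
  shows "wexc (Suc m) (\<tau> \<circ> inv (cyc (Suc m))) = Suc (exc m \<tau>)"
proof -
  have top: "\<tau> (Suc m) = Suc m"
    using permutes_not_in[OF assms(1), of "Suc m"] by auto
  have "{i \<in> {1..Suc m}. (\<tau> \<circ> inv (cyc (Suc m))) i \<ge> i}
      = insert 1 (Suc ` {i \<in> {1..m}. \<tau> i > i})" (is "?L = ?R")
  proof (intro set_eqI)
    fix i show "i \<in> ?L \<longleftrightarrow> i \<in> ?R"
      using top by (cases i; cases "i = 1") (auto simp: inv_cyc image_iff)
  qed
  then show ?thesis
    unfolding exc_def wexc_def by (subst \<open>?L = ?R\<close>) (auto simp: card_insert_if card_image)
qed

lemma des_max_last:
  assumes "\<tau> permutes {1..m}"
  shows "des (Suc m) \<tau> = des m \<tau>"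
proof -
  have "\<tau> m \<le> Suc m" "\<tau> (Suc m) = Suc m"
    using permutes_not_in[OF assms, of "Suc m"] permutes_in_image[OF assms, of m]
      permutes_not_in[OF assms, of m] by (cases "m \<in> {1..m}"; force)+
  then have "{i \<in> {1..<Suc m}. \<tau> i > \<tau> (i + 1)} = {i \<in> {1..<m}. \<tau> i > \<tau> (i + 1)}"
    by (auto simp: less_Suc_eq)
  then show ?thesis unfolding des_def by simp
qed

lemma wexc_max_last:
  assumes "\<tau> permutes {1..m}"
  shows "wexc (Suc m) \<tau> = Suc (wexc m \<tau>)"
proof -
  have "{i \<in> {1..Suc m}. \<tau> i \<ge> i} = insert (Suc m) {i \<in> {1..m}. \<tau> i \<ge> i}"
    using permutes_not_in[OF assms, of "Suc m"] by (auto simp: le_Suc_eq)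
  then show ?thesis unfolding wexc_def by simp
qed

text \<open>The cyclic shift pairs the terms of both sums on the left, and they cancel unless the
  maximum stands at an end. A maximum in first place yields the part with \<open>A_poly m\<close>,
  one in last place the part with \<open>W_poly m\<close>.\<close>

lemma W_poly_minus_A_poly:
  "W_poly (Suc m) - var_t * A_poly (Suc m) = (var_s - 1) * var_t * (A_poly m - W_poly m)"
proof (cases "m = 0")
  \<comment> \<open>For a single entry the first and the last place coincide, so the splitting below
    would not be disjoint.\<close>
  case True
  then show ?thesis
    by (simp add: W_poly_def A_poly_def des_def exc_def wexc_def)
next
  case False
  let ?N = "Suc m"
  let ?P = "{\<pi>. \<pi> permutes {1..?N}}"
  let ?F = "{\<pi>. \<pi> permutes {1..?N} \<and> \<pi> 1 = ?N}" and ?L = "{\<pi>. \<pi> permutes {1..?N} \<and> \<pi> ?N = ?N}"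
  define g where "g \<pi> = (var_s ^ des ?N \<pi> - var_s ^ des ?N (cyc ?N \<circ> \<pi>)) * var_t ^ wexc ?N \<pi>" for \<pi>
  have c: "cyc ?N permutes {1..?N}"
    by (rule cyc_permutes) simp
  have des_shift: "des ?N (cyc ?N \<circ> \<pi>) + of_bool (\<pi> 1 = ?N) = des ?N \<pi> + of_bool (\<pi> ?N = ?N)"
    if "\<pi> permutes {1..?N}" for \<pi>
    by (rule des_cyc) (use that in auto)
  have not_both: "\<pi> 1 \<noteq> ?N \<or> \<pi> ?N \<noteq> ?N" if "\<pi> permutes {1..?N}" for \<pi>
    using permutes_inj[OF that] False by (metis One_nat_def Suc_inject injD)
  have fin: "finite ?P"
    by (rule finite_permutations) simp
  have "bij_betw (\<lambda>\<pi>. cyc ?N \<circ> \<pi>) ?P ?P"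
    by (rule bij_betw_byWitness[where f' = "\<lambda>\<pi>. inv (cyc ?N) \<circ> \<pi>"])
      (auto simp: comp_assoc[symmetric] permutes_inv_o[OF c] simp del: One_nat_def intro!: permutes_compose c permutes_inv)
  from sum.reindex_bij_betw[OF this, of "\<lambda>\<pi>. var_s ^ des ?N \<pi> * var_t ^ exc ?N \<pi>"]
  have "var_t * A_poly ?N
      = (\<Sum>\<pi> \<in> ?P. var_t * (var_s ^ des ?N (cyc ?N \<circ> \<pi>) * var_t ^ exc ?N (cyc ?N \<circ> \<pi>)))"
    unfolding A_poly_def sum_distrib_left[symmetric] by simp
  \<comment> \<open>The factor t makes up for the weak excedance lost in the shift.\<close>
  also have "\<dots> = (\<Sum>\<pi> \<in> ?P. var_s ^ des ?N (cyc ?N \<circ> \<pi>) * var_t ^ wexc ?N \<pi>)"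
    by (intro sum.cong refl) (simp add: Suc_exc_cyc[symmetric] mult_ac)
  finally have "W_poly ?N - var_t * A_poly ?N = sum g ?P"
    by (simp add: W_poly_def g_def sum_subtractf left_diff_distrib)
  also have "\<dots> = sum g (?F \<union> ?L)"
  proof (rule sum.mono_neutral_right[OF fin])
    \<comment> \<open>An interior maximum makes both indicators in \<open>des_shift\<close>
      vanish.\<close>
    show "\<forall>\<pi> \<in> ?P - (?F \<union> ?L). g \<pi> = 0"
    proof
      fix \<pi> assume "\<pi> \<in> ?P - (?F \<union> ?L)"
      then have "des ?N (cyc ?N \<circ> \<pi>) = des ?N \<pi>"
        using des_shift[of \<pi>] by simp
      then show "g \<pi> = 0" by (simp add: g_def)
    qed
  qed auto
  also have "\<dots> = sum g ?F + sum g ?L"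
  proof (rule sum.union_disjoint)
    show "finite ?F" "finite ?L"
      by (rule finite_subset[OF _ fin]; blast)+
  qed (use not_both in blast)
  also have "sum g ?F = (\<Sum>\<tau> | \<tau> permutes {1..m}. g (\<tau> \<circ> inv (cyc ?N)))"
    by (rule sum.reindex_bij_betw[OF bij_betw_max_first, symmetric])
  also have "\<dots> = (\<Sum>\<tau> | \<tau> permutes {1..m}. (var_s - 1) * var_t * (var_s ^ des m \<tau> * var_t ^ exc m \<tau>))"
  proof (intro sum.cong refl)
    fix \<tau> assume "\<tau> \<in> {\<tau>. \<tau> permutes {1..m}}"
    then have \<tau>: "\<tau> permutes {1..m}" by simp
    let ?\<pi> = "\<tau> \<circ> inv (cyc ?N)"
    have "?\<pi> permutes {1..?N}" "?\<pi> 1 = ?N"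
      using bij_betw_apply[OF bij_betw_max_first, of \<tau> m] \<tau> by auto
    then have "Suc (des ?N (cyc ?N \<circ> ?\<pi>)) = des ?N ?\<pi>"
      using des_shift[of ?\<pi>] not_both[of ?\<pi>] by simp
    \<comment> \<open>The shift removes just the descent that the leading maximum had added.\<close>
    then have "des ?N (cyc ?N \<circ> ?\<pi>) = des m \<tau>"
      using des_max_first[OF \<tau>] False by simp
    then show "g ?\<pi> = (var_s - 1) * var_t * (var_s ^ des m \<tau> * var_t ^ exc m \<tau>)"
      using des_max_first[OF \<tau>] wexc_max_first[OF \<tau>] False
      by (simp add: g_def algebra_simps)
  qed
  also have "\<dots> = (var_s - 1) * var_t * A_poly m"
    by (simp add: A_poly_def sum_distrib_left)
  also have "sum g ?L = (\<Sum>\<tau> | \<tau> permutes {1..m}. - ((var_s - 1) * var_t * (var_s ^ des m \<tau> * var_t ^ wexc m \<tau>)))"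
  proof (rule sum.cong)
    fix \<tau> assume "\<tau> \<in> {\<tau>. \<tau> permutes {1..m}}"
    then have \<tau>: "\<tau> permutes {1..m}" by simp
    then have "\<tau> permutes {1..?N}" "\<tau> ?N = ?N"
      using permutes_max_last_iff[of \<tau> m] by auto
    \<comment> \<open>The shift replaces the final maximum by 1, which creates a last descent; this
      gives the opposite sign.\<close>
    then have "des ?N (cyc ?N \<circ> \<tau>) = Suc (des m \<tau>)"
      using des_shift[of \<tau>] not_both[of \<tau>] des_max_last[OF \<tau>] by simp
    then show "g \<tau> = - ((var_s - 1) * var_t * (var_s ^ des m \<tau> * var_t ^ wexc m \<tau>))"
      using des_max_last[OF \<tau>] wexc_max_last[OF \<tau>] by (simp add: g_def algebra_simps)
  qed (simp only: permutes_max_last_iff)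
  also have "\<dots> = - ((var_s - 1) * var_t * W_poly m)"
    by (simp only: W_poly_def sum_distrib_left sum_negf)
  finally show ?thesis
    by (simp add: right_diff_distrib)
qed

section \<open>Substituting $1/t$ for $t$\<close>

lemma subst_inv_t_0 [simp]: "subst_inv_t 0 = 0"
  by (simp add: subst_inv_t_def)

text \<open>Horner's rule at 1/t, from which induction shows that the substitution is a ring
  homomorphism.\<close>

lemma subst_inv_t_pCons:
  "subst_inv_t (pCons c p) = to_fract [:c:] + 1 / to_fract var_t * subst_inv_t p"
  by (simp add: subst_inv_t_def map_poly_pCons)

lemma subst_inv_t_add [simp]: "subst_inv_t (p + q) = subst_inv_t p + subst_inv_t q"
proof (induction p q rule: poly_induct2)
  case (pCons a p b q)
  have "to_fract [:a + b:] = to_fract [:a:] + (to_fract [:b:] :: int poly poly fract)"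
    by (simp flip: to_fract_add)
  then show ?case
    using pCons by (simp add: subst_inv_t_pCons ring_distribs add_ac)
qed simp

lemma subst_inv_t_smult: "subst_inv_t (smult c p) = to_fract [:c:] * subst_inv_t p"
proof (induction p)
  case (pCons a p)
  have "to_fract [:c * a:] = to_fract [:c:] * (to_fract [:a:] :: int poly poly fract)"
    by (simp flip: to_fract_mult)
  then show ?case
    using pCons by (simp add: subst_inv_t_pCons ring_distribs mult_ac)
qed simp

lemma subst_inv_t_mult [simp]: "subst_inv_t (p * q) = subst_inv_t p * subst_inv_t q"
  by (induction p) (simp_all add: subst_inv_t_pCons subst_inv_t_smult ring_distribs mult_ac)

lemma subst_inv_t_1 [simp]: "subst_inv_t 1 = 1"
  using subst_inv_t_pCons[of 1 0] by (simp add: one_pCons[symmetric])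

lemma subst_inv_t_minus [simp]: "subst_inv_t (- p) = - subst_inv_t p"
  using subst_inv_t_add[of p "- p"] by (simp add: add_eq_0_iff del: subst_inv_t_add)

lemma subst_inv_t_diff [simp]: "subst_inv_t (p - q) = subst_inv_t p - subst_inv_t q"
  using subst_inv_t_add[of p "- q"] by (simp del: subst_inv_t_add)

lemma subst_inv_t_power [simp]: "subst_inv_t (p ^ k) = subst_inv_t p ^ k"
  by (induction k) simp_all

lemma subst_inv_t_sum: "subst_inv_t (sum f A) = (\<Sum>x\<in>A. subst_inv_t (f x))"
  by (induction A rule: infinite_finite_induct) simp_all

lemma subst_inv_t_var_s [simp]: "subst_inv_t var_s = to_fract var_s"
  by (simp add: var_s_def subst_inv_t_pCons)

lemma subst_inv_t_var_t [simp]: "subst_inv_t var_t = 1 / to_fract var_t"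
  by (simp add: var_t_def subst_inv_t_pCons one_pCons[symmetric])

lemma var_t_nonzero [simp]: "var_t \<noteq> 0"
  by (simp add: var_t_def)

lemma one_minus_var_t_nonzero: "1 - to_fract var_t \<noteq> (0 :: int poly poly fract)"
proof -
  have "1 - var_t \<noteq> 0"
    by (simp add: var_t_def one_pCons)
  then have "to_fract (1 - var_t) \<noteq> 0"
    by (simp only: to_fract_eq_0_iff not_False_eq_True)
  then show ?thesis
    by simp
qed

lemma to_fract_power: "to_fract (p ^ k) = to_fract p ^ k"
  by (induction k) simp_all

lemma to_fract_sum: "to_fract (sum f A) = (\<Sum>x\<in>A. to_fract (f x))"
  by (induction A rule: infinite_finite_induct) simp_all

text \<open>Termwise, since \<open>exc n \<pi> \<le> n\<close>, with \<open>W_poly n\<close> in its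
  reversed form.\<close>

lemma subst_inv_t_A_poly: "to_fract var_t ^ n * subst_inv_t (A_poly n) = to_fract (W_poly n)"
proof -
  let ?t = "to_fract var_t :: int poly poly fract"
  have "?t ^ n * (x * (1 / ?t) ^ exc n \<pi>) = x * ?t ^ (n - exc n \<pi>)" for x \<pi>
    using exc_le[of n \<pi>] by (simp add: power_one_over power_diff)
  then show ?thesis
    by (simp only: W_poly_eq_reversed A_poly_def subst_inv_t_sum subst_inv_t_mult subst_inv_t_power
        subst_inv_t_var_s subst_inv_t_var_t to_fract_sum to_fract_mult to_fract_power sum_distrib_left)
qed

text \<open>With the preceding lemma, substituting 1/t and multiplying by \<open>t^n\<close> swaps
  the two polynomials, so their difference changes sign.\<close>

lemma subst_inv_t_W_poly: "to_fract var_t ^ n * subst_inv_t (W_poly n) = to_fract (A_poly n)"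
proof -
  let ?t = "to_fract var_t :: int poly poly fract"
  have "?t ^ n * (x * (1 / ?t) ^ (n - exc n \<pi>)) = x * ?t ^ exc n \<pi>" for x \<pi>
  proof -
    have "?t ^ n = ?t ^ exc n \<pi> * ?t ^ (n - exc n \<pi>)"
      using exc_le[of n \<pi>] by (simp flip: power_add)
    then show ?thesis by (simp add: power_one_over)
  qed
  then show ?thesis
    by (simp only: W_poly_eq_reversed A_poly_def subst_inv_t_sum subst_inv_t_mult subst_inv_t_power
        subst_inv_t_var_s subst_inv_t_var_t to_fract_sum to_fract_mult to_fract_power sum_distrib_left)
qed

section \<open>The decomposition\<close>

text \<open>The claimed decomposition, solved for its first component and read as a recursion.
  Polynomiality is then automatic, and what remains is to identify the result with the quotient
  \<open>a_rat\<close>.\<close>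

fun a_poly :: "nat \<Rightarrow> int poly poly" where
  "a_poly 0 = 0"
| "a_poly (Suc n) = A_poly (Suc n) - (var_s - 1) * var_t * a_poly n"

text \<open>After multiplying the recursion by 1 - t, the induction hypothesis turns the subtracted
  term into the right side of \<open>W_poly_minus_A_poly\<close>; the terms
  \<open>var_t * A_poly (Suc n)\<close> then cancel.\<close>

lemma a_poly_eq: "(1 - var_t) * a_poly n = A_poly n - W_poly n"
proof (induction n)
  case 0
  then show ?case by (simp add: A_poly_def W_poly_def exc_def wexc_def)
next
  case (Suc n)
  have "(1 - var_t) * a_poly (Suc n)
      = (1 - var_t) * A_poly (Suc n) - (var_s - 1) * var_t * ((1 - var_t) * a_poly n)"
    by (simp add: algebra_simps)
  also have "\<dots> = (1 - var_t) * A_poly (Suc n) - (W_poly (Suc n) - var_t * A_poly (Suc n))"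
    by (simp add: Suc W_poly_minus_A_poly)
  finally show ?case by (simp add: algebra_simps)
qed

lemma to_fract_a_poly: "to_fract (a_poly n) = a_rat n"
proof (cases "n = 0")
  case False
  have "to_fract (a_poly n) * (1 - to_fract var_t) = to_fract (A_poly n) - to_fract (W_poly n)"
    using arg_cong[OF a_poly_eq[of n], of to_fract] by (simp add: mult.commute)
  then show ?thesis
    using False one_minus_var_t_nonzero by (simp add: a_rat_def subst_inv_t_A_poly nonzero_eq_divide_eq)
qed (simp add: a_rat_def)

text \<open>Under the substitution scaled by \<open>t^n\<close> the difference A - W changes sign,
  while 1 - t becomes -(1 - t)/t. The signs cancel in the quotient, and the factor 1/t lowers the
  exponent from n to n - 1.\<close>

lemma t_symmetric_a_poly: "t_symmetric (int n - 1) (a_poly n)"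
proof -
  let ?t = "to_fract var_t :: int poly poly fract"
  have t: "?t \<noteq> 0" "1 - ?t \<noteq> 0"
    using one_minus_var_t_nonzero by simp_all
  have "(1 - 1 / ?t) * (?t ^ n * subst_inv_t (a_poly n)) = ?t ^ n * subst_inv_t ((1 - var_t) * a_poly n)"
    by (simp add: mult_ac)
  also have "\<dots> = to_fract (W_poly n) - to_fract (A_poly n)"
    unfolding a_poly_eq by (simp add: right_diff_distrib subst_inv_t_A_poly subst_inv_t_W_poly)
  also have "\<dots> = - ((1 - ?t) * to_fract (a_poly n))"
    using arg_cong[OF a_poly_eq[of n], of to_fract] by simp
  finally have "(1 - ?t) * (?t ^ n * subst_inv_t (a_poly n)) = (1 - ?t) * (?t * to_fract (a_poly n))"
    using t by (simp add: field_simps)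
  then have "?t ^ n * subst_inv_t (a_poly n) = ?t * to_fract (a_poly n)"
    using t by (metis mult_cancel_left)
  then show ?thesis
    using t by (simp add: t_symmetric_def power_int_diff field_simps)
qed

text \<open>Meant for the factor \<open>var_s - 1\<close>, which is free of t.\<close>

lemma t_symmetric_mult_const:
  assumes "t_symmetric d p" "subst_inv_t c = to_fract c"
  shows "t_symmetric d (c * p)"
  using assms by (simp add: t_symmetric_def mult.left_commute)

theorem theorem4:
  fixes n :: nat
  assumes "n \<ge> 1"
  shows "\<exists>p q :: int poly poly.
           to_fract p = a_rat n \<and> to_fract q = a_rat (n - 1) \<and>
           t_symmetric (int n - 1) p \<and>
           t_symmetric_decomposition n (A_poly n) p ((var_s - 1) * q)"
proof (intro exI conjI)
  obtain m where n: "n = Suc m"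
    using assms by (cases n) auto
  have "A_poly n = a_poly n + var_t * ((var_s - 1) * a_poly (n - 1))"
    by (simp add: n algebra_simps)
  \<comment> \<open>Here \<open>int n - 2 = int m - 1\<close> is the exponent belonging to
    \<open>a_poly m\<close>; for \<open>m = 0\<close> it is -1 and the component is 0.\<close>
  moreover have "t_symmetric (int n - 2) ((var_s - 1) * a_poly (n - 1))"
    using t_symmetric_a_poly[of m] by (intro t_symmetric_mult_const) (simp_all add: n)
  ultimately show "t_symmetric_decomposition n (A_poly n) (a_poly n) ((var_s - 1) * a_poly (n - 1))"
    using t_symmetric_a_poly unfolding t_symmetric_decomposition_def by simp
qed (rule to_fract_a_poly t_symmetric_a_poly)+

end
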